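(* Let $(T,d)$ be a metric space with $D(T)<\infty$ and $m$ a Borel probability measure on $T$ with $\operatorname{supp}(m)=T$. Let $a,b\ge0$, $\varphi\in\mathcal{G}_{a,b}$, $R\ge2$, and let $k_0\in\mathbb{Z}$ be the integer with $R^{k_0}\le\varphi^{-1}(1)<R^{k_0+1}$. Set $r_{k_0}(x):=D(T)$ for $x\in T$, and for integers $k>k_0$ and $x\in T$ set $$r_k(x):=\min\left\{\varepsilon\ge0:\varphi^{-1}\left(\frac{1}{m(B(x,\varepsilon))}\right)\le R^k\right\}.$$ For $k\ge k_0$ let $B_k(x):=B(x,r_k(x))$ and let $S_k$ be the linear operator on the space of bounded Borel functions on $T$ given by $$S_kf(x):=\frac{1}{m(B_k(x))}\int_{B_k(x)}f(u)\,m(du).$$ Then for all integers $n>k\ge k_0$, pointwise on $T$, $$S_nS_{n-1}\cdots S_{k+1}r_k\le\sum_{i=k}^{n}2^{i-k}r_i.$$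
   Context: $B(x,\varepsilon)=\{y\in T:d(x,y)\le\varepsilon\}$ is the closed ball and $D(T)=\sup\{d(s,t):s,t\in T\}$ the diameter of $T$. For $a,b\ge0$, $\mathcal{G}_{a,b}$ is the class of all functions $\varphi:\mathbb{R}_+\to\mathbb{R}$ that are (strictly) increasing and continuous, satisfy $\varphi(0)=0$, and satisfy $x\le a+b\frac{\varphi(xy)}{\varphi(y)}$ for all $x\ge 0$, $y\ge\varphi^{-1}(1)$; it is understood that the inverse $\varphi^{-1}$ is defined on $[0,\infty)$. In the definition of $r_k$, values of $\varepsilon$ with $m(B(x,\varepsilon))=0$ (possible only for $\varepsilon=0$) are regarded as giving $\varphi^{-1}(1/0)=+\infty$. *)

theory Defs
  imports "HOL-Probability.Probability"
begin

definition measure_support :: "'a::topological_space measure \<Rightarrow> 'a set" where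
  "measure_support m = {x. \<forall>U. open U \<and> x \<in> U \<longrightarrow> emeasure m U > 0}"

definition phi_inv :: "(real \<Rightarrow> real) \<Rightarrow> real \<Rightarrow> real" where
  "phi_inv \<phi> = inv_into {0..} \<phi>"

text \<open>
  Functions on the half line are total functions of which only the values on \<open>{0..}\<close> are
  constrained. The surjectivity condition expresses that the inverse is defined on
  \<open>{0..}\<close>.
\<close>

definition growth_class :: "real \<Rightarrow> real \<Rightarrow> (real \<Rightarrow> real) set" where
  "growth_class a b = {\<phi>.
     strict_mono_on {0..} \<phi> \<and> continuous_on {0..} \<phi> \<and> \<phi> 0 = 0 \<and> \<phi> ` {0..} = {0..} \<and>
     (\<forall>x\<ge>0. \<forall>y\<ge>phi_inv \<phi> 1. x \<le> a + b * (\<phi> (x * y) / \<phi> y))}"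

text \<open>
  The explicit condition that the ball has nonzero measure implements the convention that the
  inverse of \<open>\<phi>\<close> at \<open>1/0\<close> is infinite; it is needed because \<open>1/0 = 0\<close> in HOL. The minimum exists
  (for \<open>k > k0\<close>) since the measure of a closed ball is right-continuous in its radius.
\<close>

definition radius ::
  "'a::metric_space measure \<Rightarrow> (real \<Rightarrow> real) \<Rightarrow> real \<Rightarrow> int \<Rightarrow> int \<Rightarrow> 'a \<Rightarrow> real" where
  "radius m \<phi> R k0 k x =
     (if k = k0 then diameter (UNIV :: 'a set)
      else (LEAST \<epsilon>. \<epsilon> \<ge> 0 \<and> measure m (cball x \<epsilon>) \<noteq> 0 \<and>
                     phi_inv \<phi> (1 / measure m (cball x \<epsilon>)) \<le> R powi k))"

definition kball ::
  "'a::metric_space measure \<Rightarrow> (real \<Rightarrow> real) \<Rightarrow> real \<Rightarrow> int \<Rightarrow> int \<Rightarrow> 'a \<Rightarrow> 'a set" where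
  "kball m \<phi> R k0 k x = cball x (radius m \<phi> R k0 k x)"

definition avg_op ::
  "'a::metric_space measure \<Rightarrow> (real \<Rightarrow> real) \<Rightarrow> real \<Rightarrow> int \<Rightarrow> int \<Rightarrow> ('a \<Rightarrow> real) \<Rightarrow> 'a \<Rightarrow> real" where
  "avg_op m \<phi> R k0 k f x =
     1 / measure m (kball m \<phi> R k0 k x) * (LINT u:kball m \<phi> R k0 k x|m. f u)"

text \<open>
  Since \<open>fold g [x\<^sub>1, \<dots>, x\<^sub>j] s = g x\<^sub>j (\<dots> (g x\<^sub>1 s))\<close>, this is the composition
  \<open>S\<^sub>n S\<^sub>n\<^sub>-\<^sub>1 \<dots> S\<^sub>k\<^sub>+\<^sub>1\<close>, with \<open>S\<^sub>k\<^sub>+\<^sub>1\<close> applied first.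
\<close>

definition avg_comp ::
  "'a::metric_space measure \<Rightarrow> (real \<Rightarrow> real) \<Rightarrow> real \<Rightarrow> int \<Rightarrow> int \<Rightarrow> int \<Rightarrow> ('a \<Rightarrow> real) \<Rightarrow> 'a \<Rightarrow> real" where
  "avg_comp m \<phi> R k0 n k f = fold (avg_op m \<phi> R k0) [k + 1..n] f"

end

theory Submission
  imports Defs
begin

text \<open>
  Each radius function is 1-Lipschitz, since \<open>B(x, r\<^sub>k(x)) \<subseteq> B(y, r\<^sub>k(x) + d(x,y))\<close>. Hence on
  \<open>B\<^sub>n(x)\<close> the function \<open>\<Sum>i=k..n-1. 2\<^sup>i\<^sup>-\<^sup>k r\<^sub>i\<close> exceeds its value at \<open>x\<close> by at most
  \<open>(2\<^sup>n\<^sup>-\<^sup>k - 1) r\<^sub>n(x)\<close>, and the claim follows by induction on \<open>n\<close>. Since averages are only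
  compared with constants, no measurability of the iterated averages is needed.
\<close>

text \<open>A closed ball is the decreasing intersection of the closed balls of slightly larger
  radius, so continuity of a finite measure from above carries the bound \<open>c\<close> to the
  infimum of the admissible radii.\<close>

lemma least_cball_radius_exists:
  fixes M :: "'a::metric_space measure"
  assumes "finite_measure M" and sets: "sets M = sets borel" and "c > 0" and "c \<le> measure M (cball x e)"
  obtains r where "r \<ge> 0" "c \<le> measure M (cball x r)"
    "\<And>\<delta>. c \<le> measure M (cball x \<delta>) \<Longrightarrow> r \<le> \<delta>"
proof -
  interpret finite_measure M by fact
  define S where "S = {\<delta>. c \<le> measure M (cball x \<delta>)}"
  define r where "r = Inf S"
  \<comment> \<open>A ball of negative radius is empty, so its measure 0 stays below
    \<open>c\<close>.\<close>
  have nonneg: "\<delta> \<ge> 0" if "\<delta> \<in> S" for \<delta>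
    using that \<open>c > 0\<close> by (cases "\<delta> < 0") (auto simp: S_def)
  have "S \<noteq> {}"
    using assms by (auto simp: S_def)
  have "bdd_below S"
    using nonneg by (rule bdd_belowI)
  have "r \<ge> 0"
    unfolding r_def using \<open>S \<noteq> {}\<close> nonneg by (rule cInf_greatest)
  have "(\<Inter>i. cball x (r + 1 / real (Suc i))) = cball x r"
  proof (intro equalityI subsetI)
    fix y assume "y \<in> (\<Inter>i. cball x (r + 1 / real (Suc i)))"
    then have "dist x y \<le> r + 1 / real (Suc i)" for i
      by auto
    moreover have "(\<lambda>i. r + 1 / real (Suc i)) \<longlonglongrightarrow> r + 0"
      using LIMSEQ_inverse_real_of_nat by (intro tendsto_intros) (simp add: inverse_eq_divide)
    ultimately show "y \<in> cball x r"
      using LIMSEQ_le_const by fastforce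
  qed (auto intro: order_trans)
  moreover have "decseq (\<lambda>i. cball x (r + 1 / real (Suc i)))"
    by (auto simp: decseq_def frac_le intro!: subset_cball)
  moreover have "range (\<lambda>i. cball x (r + 1 / real (Suc i))) \<subseteq> sets M"
    by (auto simp: sets)
  ultimately have "(\<lambda>i. measure M (cball x (r + 1 / real (Suc i)))) \<longlonglongrightarrow> measure M (cball x r)"
    using finite_Lim_measure_decseq by metis
  moreover have "c \<le> measure M (cball x (r + 1 / real (Suc i)))" for i
  proof -
    obtain \<delta> where "\<delta> \<in> S" "\<delta> < r + 1 / real (Suc i)"
      using cInf_lessD[OF \<open>S \<noteq> {}\<close>, of "r + 1 / real (Suc i)"] by (auto simp: r_def)
    then show ?thesis
      using finite_measure_mono[of "cball x \<delta>" "cball x (r + 1 / real (Suc i))"]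
      by (auto simp: S_def sets subset_cball)
  qed
  ultimately have "c \<le> measure M (cball x r)"
    using LIMSEQ_le_const by blast
  moreover have "r \<le> \<delta>" if "c \<le> measure M (cball x \<delta>)" for \<delta>
    using that cInf_lower[OF _ \<open>bdd_below S\<close>] by (auto simp: r_def S_def)
  ultimately show thesis
    using that \<open>r \<ge> 0\<close> by blast
qed

text \<open>Turns the condition in \<open>radius\<close> into a threshold on the measure of the
  ball. At \<open>t = 0\<close> both sides fail: the left by its first conjunct, the right because
  \<open>\<phi> y > 0\<close>.\<close>

lemma phi_inv_inverse_le_iff:
  assumes "\<phi> \<in> growth_class a b" "y > 0" "t \<ge> 0"
  shows "t \<noteq> 0 \<and> phi_inv \<phi> (1 / t) \<le> y \<longleftrightarrow> 1 / \<phi> y \<le> t"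
proof -
  have mono: "strict_mono_on {0..} \<phi>" and "\<phi> 0 = 0" and surj: "\<phi> ` {0..} = {0..}"
    using assms(1) by (auto simp: growth_class_def)
  have pos: "\<phi> y > 0"
    using strict_mono_onD[OF mono, of 0 y] assms(2) \<open>\<phi> 0 = 0\<close> by simp
  show ?thesis
  proof (cases "t = 0")
    case False
    have "1 / t \<in> \<phi> ` {0..}"
      using surj assms(3) by simp
    then have s: "phi_inv \<phi> (1 / t) \<in> {0..}" "\<phi> (phi_inv \<phi> (1 / t)) = 1 / t"
      unfolding phi_inv_def by (rule inv_into_into, rule f_inv_into_f)
    have "phi_inv \<phi> (1 / t) \<le> y \<longleftrightarrow> 1 / t \<le> \<phi> y"
      using strict_mono_on_less_eq[OF mono s(1), of y] s(2) assms(2) by simp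
    then show ?thesis
      using False pos assms(3) by (simp add: field_simps)
  qed (use pos in simp)
qed

lemma measure_cball_eventually_1:
  fixes m :: "'a::metric_space measure"
  assumes "bounded (UNIV :: 'a set)" "prob_space m" "sets m = sets borel"
  obtains e where "measure m (cball x e) = 1"
proof -
  obtain e where "\<And>y. dist x y \<le> e"
    using assms(1) bounded_any_center[of UNIV x] by auto
  then have "cball x e = space m"
    using sets_eq_imp_space_eq[OF assms(3)] by auto
  then show thesis
    using that prob_space.prob_space[OF assms(2)] by metis
qed

text \<open>The \<open>LEAST\<close> in \<open>radius\<close> is attained: by the threshold form of
  its condition, it is the least radius whose ball has measure at least
  \<open>1 / \<phi> (R powi k)\<close>. This threshold lies in \<open>(0, 1]\<close>, and
  boundedness of the space provides a ball of measure 1.\<close>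

lemma radius_characterization:
  fixes m :: "'a::metric_space measure"
  assumes "bounded (UNIV :: 'a set)" "prob_space m" "sets m = sets borel"
    and \<phi>: "\<phi> \<in> growth_class a b" and "R > 1"
    and less: "phi_inv \<phi> 1 < R powi (k0 + 1)" and "k0 < k"
  shows "radius m \<phi> R k0 k x \<ge> 0"
    and "1 / \<phi> (R powi k) \<le> measure m (cball x (radius m \<phi> R k0 k x))"
    and "1 / \<phi> (R powi k) \<le> measure m (cball x \<delta>) \<Longrightarrow> radius m \<phi> R k0 k x \<le> \<delta>"
proof -
  interpret prob_space m by fact
  have pos: "R powi k > 0"
    using \<open>R > 1\<close> by simp
  have "phi_inv \<phi> 1 \<le> R powi k"
    using less power_int_increasing[of "k0 + 1" k R] assms(5,7) by linarith
  then have "1 / \<phi> (R powi k) \<le> 1"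
    using phi_inv_inverse_le_iff[OF \<phi> pos, of 1] by simp
  moreover obtain e where "measure m (cball x e) = 1"
    using assms(1-3) by (rule measure_cball_eventually_1)
  \<comment> \<open>At \<open>t = 0\<close> the left side of the equivalence is false, which refutes
    \<open>1 / \<phi> (R powi k) \<le> 0\<close>.\<close>
  moreover have "1 / \<phi> (R powi k) > 0"
    using phi_inv_inverse_le_iff[OF \<phi> pos, of 0] by linarith
  ultimately obtain r where r: "r \<ge> 0" "1 / \<phi> (R powi k) \<le> measure m (cball x r)"
    "\<And>\<delta>. 1 / \<phi> (R powi k) \<le> measure m (cball x \<delta>) \<Longrightarrow> r \<le> \<delta>"
    using least_cball_radius_exists[OF finite_measure_axioms assms(3), of "1 / \<phi> (R powi k)" x e] by metis
  have "radius m \<phi> R k0 k x = (LEAST \<epsilon>. \<epsilon> \<ge> 0 \<and> 1 / \<phi> (R powi k) \<le> measure m (cball x \<epsilon>))"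
    using \<open>k0 < k\<close> phi_inv_inverse_le_iff[OF \<phi> pos, OF measure_nonneg, of m]
    by (simp add: radius_def)
  also have "\<dots> = r"
    using r by (intro Least_equality) auto
  finally have eq: "radius m \<phi> R k0 k x = r" .
  show "radius m \<phi> R k0 k x \<ge> 0"
    and "1 / \<phi> (R powi k) \<le> measure m (cball x (radius m \<phi> R k0 k x))"
    and "1 / \<phi> (R powi k) \<le> measure m (cball x \<delta>) \<Longrightarrow> radius m \<phi> R k0 k x \<le> \<delta>"
    unfolding eq using r by blast+
qed

lemma radius_nonneg:
  fixes m :: "'a::metric_space measure"
  assumes "bounded (UNIV :: 'a set)" "prob_space m" "sets m = sets borel"
    and "\<phi> \<in> growth_class a b" "R > 1" "phi_inv \<phi> 1 < R powi (k0 + 1)" "k0 \<le> k"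
  shows "radius m \<phi> R k0 k x \<ge> 0"
proof (cases "k = k0")
  case True
  then show ?thesis
    using diameter_ge_0[OF assms(1)] by (simp add: radius_def)
next
  case False
  then show ?thesis
    using radius_characterization(1)[OF assms(1-6)] assms(7) by simp
qed

text \<open>For \<open>k > k0\<close> the threshold is the same at every centre, so a ball around
  \<open>y\<close> that contains the minimal ball around \<open>x\<close> reaches it too. For
  \<open>k = k0\<close> the radius is constant.\<close>

lemma radius_lipschitz:
  fixes m :: "'a::metric_space measure"
  assumes "bounded (UNIV :: 'a set)" "prob_space m" "sets m = sets borel"
    and "\<phi> \<in> growth_class a b" "R > 1" "phi_inv \<phi> 1 < R powi (k0 + 1)" "k0 \<le> k"
  shows "radius m \<phi> R k0 k y \<le> radius m \<phi> R k0 k x + dist x y"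
proof (cases "k = k0")
  case True
  then show ?thesis by (simp add: radius_def)
next
  case False
  then have "k0 < k"
    using assms(7) by simp
  note char = radius_characterization[OF assms(1-6) this]
  interpret prob_space m by fact
  let ?r = "radius m \<phi> R k0 k x"
  have "cball x ?r \<subseteq> cball y (?r + dist x y)"
  proof
    fix z assume "z \<in> cball x ?r"
    then show "z \<in> cball y (?r + dist x y)"
      using dist_triangle[of y z x] by (simp add: dist_commute)
  qed
  then have "measure m (cball x ?r) \<le> measure m (cball y (?r + dist x y))"
    by (intro finite_measure_mono) (auto simp: assms(3))
  with char(2)[of x] show ?thesis
    by (intro char(3)) simp
qed

text \<open>The function \<open>f\<close> may be arbitrary: a non-integrable integrand has integral
  0, and a null ball gives average 0 because \<open>1 / 0 = 0\<close>. The condition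
  \<open>c \<ge> 0\<close> covers both default values.\<close>

lemma avg_op_le_const:
  assumes "finite_measure m" "sets m = sets borel" "c \<ge> 0"
    and le: "\<And>u. u \<in> kball m \<phi> R k0 k x \<Longrightarrow> f u \<le> c"
  shows "avg_op m \<phi> R k0 k f x \<le> c"
proof -
  interpret finite_measure m by fact
  let ?B = "kball m \<phi> R k0 k x"
  have B: "?B \<in> sets m"
    by (simp add: kball_def assms(2))
  have "(LINT u:?B|m. f u) \<le> (LINT u:?B|m. c)"
    unfolding set_lebesgue_integral_def
  \<comment> \<open>This form of monotonicity asks for integrability of the upper bound only,
    together with its nonnegativity.\<close>
  proof (rule integral_mono')
    show "integrable m (\<lambda>u. indicator ?B u *\<^sub>R c)"
      using B by (intro integrable_scaleR_left integrable_real_indicator)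
        (simp_all add: emeasure_eq_measure)
  qed (use le \<open>c \<ge> 0\<close> in \<open>auto simp: indicator_def\<close>)
  also have "\<dots> = measure m ?B * c"
    using B by (simp add: set_lebesgue_integral_def)
  finally have int: "(LINT u:?B|m. f u) \<le> measure m ?B * c" .
  show ?thesis
  proof (cases "measure m ?B = 0")
    case False
    then have "measure m ?B > 0"
      by (simp add: zero_less_measure_iff)
    then show ?thesis
      using int by (simp add: avg_op_def field_simps)
  qed (use \<open>c \<ge> 0\<close> in \<open>simp add: avg_op_def\<close>)
qed

lemma sum_powi_2:
  fixes k n :: int
  assumes "k \<le> n"
  shows "(\<Sum>i=k..n. 2 powi (i - k)) = (2 powi (n + 1 - k) - 1 :: real)"
  using assms
proof (induction n rule: int_ge_induct)
  case (step n)
  have "{k..n + 1} = insert (n + 1) {k..n}"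
    using step by auto
  moreover have "(2::real) powi (n + 1 + 1 - k) = 2 * 2 powi (n + 1 - k)"
    using power_int_add_1[of "2::real" "n + 1 - k"] by (simp add: algebra_simps)
  ultimately show ?case
    using step by simp
qed simp

theorem lemma2p2:
  fixes m :: "'a::metric_space measure"
    and \<phi> :: "real \<Rightarrow> real"
    and a b R :: real
    and k0 k n :: int
  assumes "bounded (UNIV :: 'a set)"
    and "prob_space m"
    and "sets m = sets borel"
    and "measure_support m = UNIV"
    and "a \<ge> 0" and "b \<ge> 0"
    and "\<phi> \<in> growth_class a b"
    and "R \<ge> 2"
    and "R powi k0 \<le> phi_inv \<phi> 1" and "phi_inv \<phi> 1 < R powi (k0 + 1)"
    and "k0 \<le> k" and "k < n"
  shows "\<forall>x. avg_comp m \<phi> R k0 n k (radius m \<phi> R k0 k) x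
             \<le> (\<Sum>i=k..n. 2 powi (i - k) * radius m \<phi> R k0 i x)"
proof -
  interpret prob_space m by fact
  have "R > 1"
    using \<open>R \<ge> 2\<close> by simp
  let ?r = "radius m \<phi> R k0"
  note radius_assms = assms(1-3,7) \<open>R > 1\<close> assms(10)
  note nonneg = radius_nonneg[OF radius_assms]
  note lipschitz = radius_lipschitz[OF radius_assms]
  have "k \<le> n"
    using \<open>k < n\<close> by simp
  then show ?thesis
  \<comment> \<open>The induction starts at \<open>n = k\<close>, where the composition is empty and
    both sides equal \<open>?r k x\<close>.\<close>
  proof (induction n rule: int_ge_induct)
    case base
    show ?case by (simp add: avg_comp_def)
  next
    case (step n)
    show ?case
    proof
      fix x
      let ?g = "\<lambda>x. \<Sum>i=k..n. 2 powi (i - k) * ?r i x"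
      have split: "{k..n + 1} = insert (n + 1) {k..n}"
        using step by auto
      have "avg_comp m \<phi> R k0 (n + 1) k (?r k) x
          = avg_op m \<phi> R k0 (n + 1) (avg_comp m \<phi> R k0 n k (?r k)) x"
        using step by (simp add: avg_comp_def upto_rec2)
      also have "\<dots> \<le> (\<Sum>i=k..n+1. 2 powi (i - k) * ?r i x)"
      \<comment> \<open>With \<open>x\<close> fixed, the right-hand side serves as the constant
        \<open>c\<close>; it remains to bound the inner composition by it at each \<open>u\<close>
        in the ball around \<open>x\<close>.\<close>
      proof (rule avg_op_le_const)
        show "0 \<le> (\<Sum>i=k..n+1. 2 powi (i - k) * ?r i x)"
          using nonneg \<open>k0 \<le> k\<close> by (intro sum_nonneg mult_nonneg_nonneg) auto
      next
        fix u assume "u \<in> kball m \<phi> R k0 (n + 1) x"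
        then have dist: "dist x u \<le> ?r (n + 1) x"
          by (simp add: kball_def)
        have "avg_comp m \<phi> R k0 n k (?r k) u \<le> ?g u"
          using step by blast
        also have "\<dots> \<le> (\<Sum>i=k..n. 2 powi (i - k) * (?r i x + ?r (n + 1) x))"
        proof (intro sum_mono mult_left_mono)
          fix i assume "i \<in> {k..n}"
          then show "?r i u \<le> ?r i x + ?r (n + 1) x"
            using lipschitz[of i u x] dist \<open>k0 \<le> k\<close> by simp
        qed simp
        also have "\<dots> = ?g x + (2 powi (n + 1 - k) - 1) * ?r (n + 1) x"
          using sum_powi_2[OF step(1)]
          by (simp add: distrib_left sum.distrib flip: sum_distrib_right)
        \<comment> \<open>The Lipschitz errors carry total weight
          \<open>2 powi (n + 1 - k) - 1\<close>. Rounding it up by 1 gives exactly the weight of the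
          new term \<open>i = n + 1\<close>, which is why powers of 2 occur.\<close>
        also have "\<dots> \<le> ?g x + 2 powi (n + 1 - k) * ?r (n + 1) x"
          using nonneg[of "n + 1" x] step \<open>k0 \<le> k\<close> by (simp add: left_diff_distrib)
        also have "\<dots> = (\<Sum>i=k..n+1. 2 powi (i - k) * ?r i x)"
          by (simp add: split)
        finally show "avg_comp m \<phi> R k0 n k (?r k) u \<le> (\<Sum>i=k..n+1. 2 powi (i - k) * ?r i x)" .
      qed (use assms(3) finite_measure_axioms in auto)
      finally show "avg_comp m \<phi> R k0 (n + 1) k (?r k) x
          \<le> (\<Sum>i=k..n+1. 2 powi (i - k) * ?r i x)" .
    qed
  qed
qed

end
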